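(* A non-negative integer $N$ can be represented in the form $N=l^2+m^2+4t_n$ with $l,m,n\in\mathbb{Z}$ if and only if $N$ is not of the form $4k+3$ with $k\in\mathbb{N}_0$.
   Context: $\mathbb{N}_0=\{0,1,2,\dots\}$ and $t_n=n(n+1)/2$. *)

theory Defs
  imports Main
begin

(* The index ranges over all integers, and the division is exact because n * (n + 1) is even. *)
definition triangular :: "int \<Rightarrow> int" where
  "triangular n = n * (n + 1) div 2"

end

theory Submission
  imports Defs
begin

text \<open>With \<open>z = 2n + 1\<close> the equation becomes \<open>2N + 1 = (l + m)\<^sup>2 + (l - m)\<^sup>2 + z\<^sup>2\<close>, so the point is that
  every positive \<open>M\<close> congruent to 1, 3 or 5 modulo 8 is a sum of three squares. The number of
  representations with suitable parities is shown to be four times the number of reduced forms \<open>(a, c, b)\<close> of determinant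
  \<open>ac - b\<^sup>2 = M\<close> with \<open>a, c\<close> odd and \<open>b\<close> even, and \<open>(1, M, 0)\<close> is such a form. Both counts have the
  same convolution with the odd squares, namely a multiple of the divisor sum \<open>\<sigma>\<close>, and the convolution
  determines them: for representations this is Jacobi's count of sums of four odd squares, for
  forms a class number relation of Kronecker's type, proved by bijections in the style of Liouville.\<close>

section \<open>Preliminaries\<close>

lemma card_eq_by_witness:
  assumes "\<And>x. x \<in> A \<Longrightarrow> f x \<in> B \<and> g (f x) = x"
    and "\<And>y. y \<in> B \<Longrightarrow> g y \<in> A \<and> f (g y) = y"
  shows "card A = card B"
proof -
  have "bij_betw f A B"
    by (rule bij_betw_byWitness[where f' = g]) (use assms in auto)
  then show ?thesis by (rule bij_betw_same_card)
qed

lemma card_split: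
  assumes "finite A"
  shows "card A = card {x \<in> A. P x} + card {x \<in> A. \<not> P x}"
proof -
  have "A = {x \<in> A. P x} \<union> {x \<in> A. \<not> P x}" by auto
  moreover have "card ({x \<in> A. P x} \<union> {x \<in> A. \<not> P x}) = card {x \<in> A. P x} + card {x \<in> A. \<not> P x}"
    by (rule card_Un_disjoint) (use assms in auto)
  ultimately show ?thesis by simp
qed

lemma card_trichotomy:
  fixes f g :: "'a \<Rightarrow> int"
  assumes "finite A"
  shows "card A = card {x \<in> A. f x = g x} + card {x \<in> A. f x < g x} + card {x \<in> A. g x < f x}"
proof -
  have "{x \<in> {x \<in> A. f x \<noteq> g x}. f x < g x} = {x \<in> A. f x < g x}"
    "{x \<in> {x \<in> A. f x \<noteq> g x}. \<not> f x < g x} = {x \<in> A. g x < f x}" by auto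
  moreover have "finite {x \<in> A. f x \<noteq> g x}" using assms by simp
  ultimately show ?thesis
    using card_split[OF assms, of "\<lambda>x. f x = g x"]
      card_split[of "{x \<in> A. f x \<noteq> g x}" "\<lambda>x. f x < g x"] by simp
qed

lemma abs_le_square: "\<bar>x\<bar> \<le> x\<^sup>2" for x :: int
proof (cases "x = 0")
  case False
  then have "\<bar>x\<bar> * 1 \<le> \<bar>x\<bar> * \<bar>x\<bar>" by (intro mult_left_mono) auto
  then show ?thesis by (simp add: power2_eq_square)
qed simp

lemma odd_square_mod_8:
  fixes s :: int
  assumes "odd s"
  shows "s\<^sup>2 mod 8 = 1"
proof -
  obtain k where k: "s = 2 * k + 1" using assms by (elim oddE)
  have "even (k * (k + 1))" by simp
  then obtain l where "k * (k + 1) = 2 * l" by (elim evenE)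
  then have "s\<^sup>2 = 1 + 8 * l" unfolding k by (simp add: power2_eq_square algebra_simps)
  then show ?thesis by simp
qed

definition odd_below :: "int \<Rightarrow> int set" where
  "odd_below n = {s. odd s \<and> s\<^sup>2 < n}"

lemma finite_odd_below [simp]: "finite (odd_below n)"
proof (rule finite_subset)
  show "odd_below n \<subseteq> {-n..n}"
  proof
    fix s assume "s \<in> odd_below n"
    then have "\<bar>s\<bar> < n" using abs_le_square[of s] by (simp add: odd_below_def)
    then show "s \<in> {-n..n}" by auto
  qed
qed simp

definition divisor_pairs :: "int \<Rightarrow> (int \<times> int) set" where
  "divisor_pairs n = {(d, e). 0 < d \<and> 0 < e \<and> d * e = n}"

lemma mult_pos_le:
  fixes d e :: int
  assumes "0 < d" "0 < e"
  shows "d \<le> d * e" "e \<le> d * e"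
  using assms by (simp_all add: mult_le_cancel_left1 mult_le_cancel_right1)

lemma finite_divisor_pairs [simp]: "finite (divisor_pairs n)"
proof (rule finite_subset)
  show "divisor_pairs n \<subseteq> {0..n} \<times> {0..n}"
    using mult_pos_le by (force simp: divisor_pairs_def)
qed simp

definition sigma :: "int \<Rightarrow> int" where
  "sigma n = (\<Sum>(d, e)\<in>divisor_pairs n. d)"

section \<open>Sums of four odd squares\<close>

text \<open>On the solutions of \<open>s\<^sup>2 + 4de = L\<close>, adding the summand \<open>s d\<^sup>2\<close>, which is odd in \<open>s\<close> and so sums to 0,
  makes the total over \<open>(s, d, e)\<close> and \<open>(-s, e, d)\<close> equal to \<open>(d + e)(d - s)(e + s)\<close>; this changes
  sign under Zagier's involution \<open>(s, d, e) \<mapsto> (2d - s, d, e + s - d)\<close> of the region \<open>d < e + s\<close>.\<close>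

lemma windmill_sum:
  fixes L :: int
  assumes "L mod 8 = 5"
  shows "(\<Sum>s\<in>odd_below L. (L - 5 * s\<^sup>2) * sigma ((L - s\<^sup>2) div 4)) = 0"
proof -
  define W where "W = {(s, d, e). odd s \<and> 0 < d \<and> 0 < e \<and> s\<^sup>2 + 4 * d * e = (L::int)}"
  define U where "U = {(s, d, e) \<in> W. d < e + s}"
  have W_Sigma: "W = Sigma (odd_below L) (\<lambda>s. divisor_pairs ((L - s\<^sup>2) div 4))"
  proof -
    have *: "d * e = (L - s\<^sup>2) div 4 \<longleftrightarrow> s\<^sup>2 + 4 * d * e = L" if "odd s" for s d e :: int
    proof -
      have "4 dvd L - s\<^sup>2" using assms odd_square_mod_8[OF that] by presburger
      then show ?thesis by (auto simp: algebra_simps)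
    qed
    show ?thesis
    proof (rule set_eqI, clarify)
      fix s d e :: int
      have "s\<^sup>2 < L" if "0 < d" "0 < e" "s\<^sup>2 + 4 * d * e = L"
        using that mult_pos_pos[of d e] by linarith
      then show "(s, d, e) \<in> W \<longleftrightarrow> (s, d, e) \<in> Sigma (odd_below L) (\<lambda>s. divisor_pairs ((L - s\<^sup>2) div 4))"
        using *[of s d e] by (auto simp: W_def odd_below_def divisor_pairs_def)
    qed
  qed
  have fin: "finite W" unfolding W_Sigma by (intro finite_SigmaI) auto
  have finU: "finite U" using fin unfolding U_def by (rule rev_finite_subset) auto
  define f :: "int \<times> int \<times> int \<Rightarrow> int" where "f = (\<lambda>(s, d, e). d\<^sup>2 * e - d * s\<^sup>2 + s * d\<^sup>2)"
  define r :: "int \<times> int \<times> int \<Rightarrow> int \<times> int \<times> int" where "r = (\<lambda>(s, d, e). (- s, e, d))"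
  define t :: "int \<times> int \<times> int \<Rightarrow> int \<times> int \<times> int" where "t = (\<lambda>(s, d, e). (2 * d - s, d, e + s - d))"
  \<comment> \<open>On the wall \<open>d = e + s\<close> the number \<open>L\<close> would be the
    square of the odd number \<open>d + e\<close>, hence 1 modulo 8 instead of 5.\<close>
  have nonsq: "d \<noteq> e + s" if "(s, d, e) \<in> W" for s d e
  proof
    assume "d = e + s"
    then have "L = (d + e)\<^sup>2" using that by (auto simp: W_def power2_eq_square algebra_simps)
    moreover have "odd (d + e)" using that \<open>d = e + s\<close> by (auto simp: W_def)
    ultimately show False using odd_square_mod_8 assms by force
  qed
  have WU: "sum f W = sum f U + sum f (W - U)"
    using fin by (metis (no_types, lifting) U_def add.commute mem_Collect_eq subsetI sum.subset_diff case_prodE)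
  have "sum f (W - U) = (\<Sum>x\<in>U. f (r x))"
    by (rule sum.reindex_bij_witness[of _ r r])
      (use nonsq in \<open>force simp: U_def W_def r_def algebra_simps\<close>)+
  then have "sum f W = (\<Sum>x\<in>U. f x + f (r x))" using WU by (simp add: sum.distrib)
  also have "\<dots> = (\<Sum>(s, d, e)\<in>U. (d + e) * (d - s) * (e + s))"
    by (rule sum.cong) (auto simp: f_def r_def power2_eq_square algebra_simps)
  finally have sumf: "sum f W = (\<Sum>(s, d, e)\<in>U. (d + e) * (d - s) * (e + s))" .
  have "(\<Sum>(s, d, e)\<in>U. (d + e) * (d - s) * (e + s)) = (\<Sum>(s, d, e)\<in>U. - ((d + e) * (d - s) * (e + s)))"
    by (rule sum.reindex_bij_witness[of _ t t])
      (auto simp: U_def W_def t_def power2_eq_square algebra_simps)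
  then have "sum f W = 0" unfolding sumf by (simp add: case_prod_unfold sum_negf)
  moreover have "(\<Sum>(s, d, e)\<in>W. s * d\<^sup>2) = (\<Sum>(s, d, e)\<in>W. - (s * d\<^sup>2))"
    by (rule sum.reindex_bij_witness[of _ "\<lambda>(s, d, e). (- s, d, e)" "\<lambda>(s, d, e). (- s, d, e)"])
      (auto simp: W_def)
  then have "(\<Sum>(s, d, e)\<in>W. s * d\<^sup>2) = 0" by (simp add: case_prod_unfold sum_negf)
  moreover have "sum f W = (\<Sum>(s, d, e)\<in>W. d\<^sup>2 * e - d * s\<^sup>2) + (\<Sum>(s, d, e)\<in>W. s * d\<^sup>2)"
    by (simp add: f_def case_prod_unfold sum.distrib[symmetric])
  ultimately have "(\<Sum>(s, d, e)\<in>W. d\<^sup>2 * e - d * s\<^sup>2) = 0" by simp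
  then have "4 * (\<Sum>(s, d, e)\<in>W. d\<^sup>2 * e - d * s\<^sup>2) = 0" by simp
  \<comment> \<open>The factor 4 allows substituting \<open>L - s\<^sup>2\<close> for
    \<open>4 * d * e\<close>, which leaves the weight \<open>L - 5 * s\<^sup>2\<close> on the
    divisor \<open>d\<close>.\<close>
  also have "4 * (\<Sum>(s, d, e)\<in>W. d\<^sup>2 * e - d * s\<^sup>2) = (\<Sum>(s, d, e)\<in>W. (L - 5 * s\<^sup>2) * d)"
    unfolding sum_distrib_left
    by (rule sum.cong) (auto simp: W_def power2_eq_square algebra_simps)
  also have "\<dots> = (\<Sum>s\<in>odd_below L. (L - 5 * s\<^sup>2) * sigma ((L - s\<^sup>2) div 4))"
    unfolding W_Sigma sigma_def
    by (subst sum.Sigma[symmetric]) (auto simp: sum_distrib_left case_prod_unfold)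
  finally show ?thesis by simp
qed

section \<open>Jacobi's count for four odd squares\<close>

definition four_odd :: "int \<Rightarrow> (int \<times> int \<times> int \<times> int) set" where
  "four_odd n = {(x, y, z, w). odd x \<and> odd y \<and> odd z \<and> odd w \<and> x\<^sup>2 + y\<^sup>2 + z\<^sup>2 + w\<^sup>2 = n}"

lemma finite_four_odd [simp]: "finite (four_odd n)"
proof (rule finite_subset)
  have *: "\<bar>x\<bar> \<le> n \<and> \<bar>y\<bar> \<le> n \<and> \<bar>z\<bar> \<le> n \<and> \<bar>w\<bar> \<le> n"
    if "x\<^sup>2 + y\<^sup>2 + z\<^sup>2 + w\<^sup>2 = n" for x y z w :: int
    using that abs_le_square[of x] abs_le_square[of y] abs_le_square[of z] abs_le_square[of w]
    by linarith
  show "four_odd n \<subseteq> {-n..n} \<times> {-n..n} \<times> {-n..n} \<times> {-n..n}"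
    using * by (force simp: four_odd_def abs_le_iff)
qed simp

text \<open>Over all representations of \<open>L\<close> by five odd squares, each of the five
  squares has the same total by symmetry, so five times the total of \<open>s\<^sup>2\<close> is
  \<open>L\<close> times the number of representations. This is the relation that
  \<open>windmill_sum\<close> gives for \<open>sigma\<close>.\<close>

lemma four_odd_sum:
  "(\<Sum>s\<in>odd_below L. (L - 5 * s\<^sup>2) * int (card (four_odd (L - s\<^sup>2)))) = 0"
proof -
  define Q where "Q = Sigma (odd_below L) (\<lambda>s. four_odd (L - s\<^sup>2))"
  have Q: "Q = {(s, x, y, z, w). odd s \<and> odd x \<and> odd y \<and> odd z \<and> odd w \<and>
     s\<^sup>2 + x\<^sup>2 + y\<^sup>2 + z\<^sup>2 + w\<^sup>2 = L}" (is "_ = ?Q")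
  proof -
    have "s\<^sup>2 < L" if "odd x" "s\<^sup>2 + x\<^sup>2 + y\<^sup>2 + z\<^sup>2 + w\<^sup>2 = L" for s x y z w :: int
    proof -
      have "x \<noteq> 0" using that by auto
      then have "0 < x\<^sup>2" by simp
      then show ?thesis using that zero_le_power2[of y] zero_le_power2[of z] zero_le_power2[of w]
        by linarith
    qed
    then show ?thesis by (auto simp: Q_def odd_below_def four_odd_def)
  qed
  have 1: "(\<Sum>(s, x, y, z, w)\<in>Q. s\<^sup>2) = (\<Sum>(s, x, y, z, w)\<in>Q. x\<^sup>2)"
    by (rule sum.reindex_bij_witness[of _ "\<lambda>(s, x, y, z, w). (x, s, y, z, w)" "\<lambda>(s, x, y, z, w). (x, s, y, z, w)"])
      (auto simp: Q)
  have 2: "(\<Sum>(s, x, y, z, w)\<in>Q. s\<^sup>2) = (\<Sum>(s, x, y, z, w)\<in>Q. y\<^sup>2)"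
    by (rule sum.reindex_bij_witness[of _ "\<lambda>(s, x, y, z, w). (y, x, s, z, w)" "\<lambda>(s, x, y, z, w). (y, x, s, z, w)"])
      (auto simp: Q)
  have 3: "(\<Sum>(s, x, y, z, w)\<in>Q. s\<^sup>2) = (\<Sum>(s, x, y, z, w)\<in>Q. z\<^sup>2)"
    by (rule sum.reindex_bij_witness[of _ "\<lambda>(s, x, y, z, w). (z, x, y, s, w)" "\<lambda>(s, x, y, z, w). (z, x, y, s, w)"])
      (auto simp: Q)
  have 4: "(\<Sum>(s, x, y, z, w)\<in>Q. s\<^sup>2) = (\<Sum>(s, x, y, z, w)\<in>Q. w\<^sup>2)"
    by (rule sum.reindex_bij_witness[of _ "\<lambda>(s, x, y, z, w). (w, x, y, z, s)" "\<lambda>(s, x, y, z, w). (w, x, y, z, s)"])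
      (auto simp: Q)
  have "(\<Sum>(s, x, y, z, w)\<in>Q. L - 5 * s\<^sup>2)
      = (\<Sum>(s, x, y, z, w)\<in>Q. s\<^sup>2 + x\<^sup>2 + y\<^sup>2 + z\<^sup>2 + w\<^sup>2 - 5 * s\<^sup>2)"
    by (rule sum.cong) (auto simp: Q)
  also have "\<dots> = 0"
    using 1 2 3 4 by (simp add: case_prod_unfold sum.distrib sum_subtractf sum_distrib_left[symmetric])
  finally have "(\<Sum>(s, x)\<in>Q. L - 5 * s\<^sup>2) = 0" by (simp add: case_prod_unfold)
  then show ?thesis unfolding Q_def
    by (subst (asm) sum.Sigma[symmetric]) (auto simp: mult.commute)
qed

lemma four_odd_4: "card (four_odd 4) = 16"
proof -
  have "four_odd 4 = {-1, 1} \<times> {-1, 1} \<times> {-1, 1} \<times> {-1, 1}"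
  proof -
    have sq: "x\<^sup>2 = 1 \<or> 9 \<le> x\<^sup>2" if "odd x" for x :: int
    proof -
      have "\<bar>x\<bar> = 1 \<or> 3 \<le> \<bar>x\<bar>" using that by presburger
      then show ?thesis using power_mono[of 3 "\<bar>x\<bar>" 2] by (auto simp: power2_eq_square abs_if split: if_splits)
    qed
    have "x\<^sup>2 = 1 \<and> y\<^sup>2 = 1 \<and> z\<^sup>2 = 1 \<and> w\<^sup>2 = 1"
      if "odd x" "odd y" "odd z" "odd w" "x\<^sup>2 + y\<^sup>2 + z\<^sup>2 + w\<^sup>2 = 4" for x y z w :: int
      using that sq[of x] sq[of y] sq[of z] sq[of w] by linarith
    moreover have "odd x" if "x\<^sup>2 = 1" for x :: int
      using that by (auto simp: power2_eq_1_iff)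
    ultimately have "odd x \<and> odd y \<and> odd z \<and> odd w \<and> x\<^sup>2 + y\<^sup>2 + z\<^sup>2 + w\<^sup>2 = 4 \<longleftrightarrow>
        x\<^sup>2 = 1 \<and> y\<^sup>2 = 1 \<and> z\<^sup>2 = 1 \<and> w\<^sup>2 = 1" for x y z w :: int
      by (smt (verit))
    moreover have "x \<in> {-1, 1} \<longleftrightarrow> x\<^sup>2 = 1" for x :: int
      by (auto simp: power2_eq_1_iff)
    ultimately show ?thesis
      unfolding four_odd_def by (intro set_eqI) (simp only: split_paired_all mem_Times_iff fst_conv snd_conv mem_Collect_eq case_prod_conv)
  qed
  then show ?thesis by (simp add: card_cartesian_product)
qed

text \<open>Isolates the terms with the largest argument \<open>n - s\<^sup>2\<close>, namely
  \<open>n - 1\<close>, which the inductions below determine from all others.\<close>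

lemma odd_below_rest:
  assumes "1 < n"
  shows "(\<Sum>s\<in>odd_below n. h s) = h 1 + h (- 1) + (\<Sum>s\<in>{s \<in> odd_below n. 1 < s\<^sup>2}. h s :: 'a :: comm_monoid_add)"
proof -
  have "odd_below n = {1, - 1} \<union> {s \<in> odd_below n. 1 < s\<^sup>2}"
  proof -
    have "s = 1 \<or> s = - 1 \<or> 1 < s\<^sup>2" if "odd s" for s :: int
    proof -
      have "s\<^sup>2 \<noteq> 0" using that by auto
      then have "0 < s\<^sup>2" by simp
      then show ?thesis using power2_eq_1_iff[of s] by linarith
    qed
    then show ?thesis using assms by (auto simp: odd_below_def)
  qed
  then have "(\<Sum>s\<in>odd_below n. h s) = sum h ({1, - 1} \<union> {s \<in> odd_below n. 1 < s\<^sup>2})" by simp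
  also have "\<dots> = sum h {1, - 1} + sum h {s \<in> odd_below n. 1 < s\<^sup>2}"
    by (rule sum.union_disjoint) auto
  finally show ?thesis by (simp add: add.assoc)
qed

text \<open>For \<open>L = 4 * m + 1\<close> both sides satisfy the same weighted relation, and
  strong induction removes every term of the difference except those at \<open>s = 1\<close> and
  \<open>s = - 1\<close>. Their weight is \<open>L - 5 = 4 * (m - 1)\<close>, so only
  \<open>m = 1\<close> has to be counted directly.\<close>

lemma card_four_odd:
  assumes "odd m" "0 < m"
  shows "int (card (four_odd (4 * m))) = 16 * sigma m"
  using assms
proof (induction "nat m" arbitrary: m rule: less_induct)
  case less
  show ?case
  proof (cases "m = 1")
    case True
    have "divisor_pairs 1 = {(1, 1)}" by (auto simp: divisor_pairs_def zmult_eq_1_iff)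
    then show ?thesis using True four_odd_4 by (simp add: sigma_def)
  next
    case False
    define L where "L = 4 * m + 1"
    have "L mod 8 = 5" using less.prems unfolding L_def by presburger
    define D where "D = (\<lambda>s. (L - 5 * s\<^sup>2) * (int (card (four_odd (L - s\<^sup>2))) - 16 * sigma ((L - s\<^sup>2) div 4)))"
    have "(\<Sum>s\<in>odd_below L. D s) = 0"
      using four_odd_sum[of L] windmill_sum[OF \<open>L mod 8 = 5\<close>]
      by (simp add: D_def right_diff_distrib sum_subtractf mult.left_commute[of _ 16]
          flip: sum_distrib_left)
    moreover have "D s = 0" if "s \<in> {s \<in> odd_below L. 1 < s\<^sup>2}" for s
    proof -
      define k where "k = (L - s\<^sup>2) div 4"
      have "odd s" "s\<^sup>2 < L" "1 < s\<^sup>2" using that by (auto simp: odd_below_def)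
      \<comment> \<open>Here \<open>L - s\<^sup>2\<close> is 4 modulo 8, so the quotient by 4 is
        again odd.\<close>
      then have k: "L - s\<^sup>2 = 4 * k" "odd k"
        using odd_square_mod_8[of s] \<open>L mod 8 = 5\<close> unfolding k_def by presburger+
      then have "0 < k" "k < m" using \<open>s\<^sup>2 < L\<close> \<open>1 < s\<^sup>2\<close> by (auto simp: L_def)
      then have "int (card (four_odd (4 * k))) = 16 * sigma k"
        using less.hyps[of k] \<open>odd k\<close> by auto
      then show ?thesis using k by (simp add: D_def)
    qed
    moreover have "1 < L" using less.prems by (simp add: L_def)
    ultimately have "D 1 + D (- 1) = 0" using odd_below_rest[of L D] by simp
    then have "(4 * m - 4) * (int (card (four_odd (4 * m))) - 16 * sigma m) = 0"
      by (simp add: D_def L_def)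
    then show ?thesis using False by simp
  qed
qed

section \<open>A class number relation\<close>

definition line_start :: "int \<Rightarrow> (int \<Rightarrow> int \<Rightarrow> bool) \<Rightarrow> (int \<times> int \<times> int \<times> int) set" where
  "line_start m P = {(h, y, x, k). 0 < h \<and> odd y \<and> 0 < y \<and> 0 < k \<and> k \<le> x \<and> P x k \<and>
     2 * h\<^sup>2 + y * x + 2 * h * k = m}"

definition line_end :: "int \<Rightarrow> (int \<Rightarrow> int \<Rightarrow> bool) \<Rightarrow> (int \<times> int \<times> int \<times> int) set" where
  "line_end m P = {(h, y, x, k). 0 < h \<and> odd y \<and> 0 < y \<and> y < 2 * h \<and> 0 < x \<and> 0 < k \<and> P x k \<and>
     2 * h\<^sup>2 + y * x + 2 * h * k = m}"

text \<open>On a solution line \<open>(y + 2ht, k - xt)\<close> both normalisations pick at most one point, and each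
  exists exactly when the line meets the positive quadrant.\<close>

lemma card_line_start_eq_line_end:
  assumes P: "\<And>x k q. P x (k + x * q) \<longleftrightarrow> P x k"
  shows "card (line_start m P) = card (line_end m P)"
\<comment> \<open>Reducing \<open>y\<close> modulo \<open>2 * h\<close> cannot produce 0 because
  \<open>y\<close> is odd. The range for \<open>k\<close> is \<open>1..x\<close> rather than
  \<open>0..x - 1\<close>, hence the shift by 1.\<close>
proof (rule card_eq_by_witness[where f = "\<lambda>(h, y, x, k). (h, y mod (2 * h), x, k + x * (y div (2 * h)))"
      and g = "\<lambda>(h, y, x, k). (h, y + 2 * h * ((k - 1) div x), x, (k - 1) mod x + 1)"], goal_cases)
  case (1 p)
  then obtain h y x k where p: "p = (h, y, x, k)" and h: "0 < h" and y: "odd y" "0 < y"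
    and k: "0 < k" "k \<le> x" "P x k" and eq: "2 * h\<^sup>2 + y * x + 2 * h * k = m"
    by (auto simp: line_start_def)
  define q where "q = y div (2 * h)"
  define z where "z = y mod (2 * h)"
  have yq: "y = z + 2 * h * q" by (simp add: q_def z_def)
  have "0 \<le> q" using h y by (simp add: q_def pos_imp_zdiv_nonneg_iff)
  have "odd z" using y unfolding yq by simp
  moreover have "0 \<le> z" "z < 2 * h" using h by (simp_all add: z_def)
  ultimately have z: "0 < z" "z < 2 * h" "odd z" by (auto simp: order_less_le)
  have "(k - 1 + x * q) div x = q" "(k - 1 + x * q) mod x = k - 1"
    using k by simp_all
  then have "(k + x * q - 1) div x = q" "(k + x * q - 1) mod x = k - 1"
    by (simp_all add: algebra_simps)
  moreover have "0 < k + x * q" using k \<open>0 \<le> q\<close> by (simp add: add_pos_nonneg)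
  moreover have "2 * h\<^sup>2 + z * x + 2 * h * (k + x * q) = m" using eq unfolding yq by (simp add: algebra_simps)
  ultimately show ?case
    using h z k P yq unfolding p by (simp add: line_end_def flip: q_def z_def)
next
  case (2 p)
  then obtain h y x k where p: "p = (h, y, x, k)" and h: "0 < h" and y: "odd y" "0 < y" "y < 2 * h"
    and k: "0 < x" "0 < k" "P x k" and eq: "2 * h\<^sup>2 + y * x + 2 * h * k = m"
    by (auto simp: line_end_def)
  define q where "q = (k - 1) div x"
  define z where "z = (k - 1) mod x"
  have kq: "k = z + 1 + x * q"
    using mult_div_mod_eq[of x "k - 1"] by (simp add: q_def z_def algebra_simps)
  have "0 \<le> q" using k by (simp add: q_def pos_imp_zdiv_nonneg_iff)
  then have "0 \<le> 2 * h * q" using h by simp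
  moreover have "0 \<le> z" "z < x" using k by (simp_all add: z_def)
  moreover have "P x (z + 1)" using k(3) unfolding kq by (simp add: P)
  moreover have "(y + 2 * h * q) div (2 * h) = q" "(y + 2 * h * q) mod (2 * h) = y"
    using y h by simp_all
  moreover have "2 * h\<^sup>2 + (y + 2 * h * q) * x + 2 * h * (z + 1) = m"
    using eq unfolding kq by (simp add: algebra_simps)
  ultimately show ?case
    using h y k(1) kq unfolding p by (simp add: line_start_def flip: q_def z_def)
qed

section \<open>Shells and their balance\<close>

text \<open>A form together with an odd \<open>s\<close> is encoded by \<open>u = s - b\<close>, \<open>v = a + b\<close> and \<open>c = a + 2j\<close>, which
  turns \<open>ac - b\<^sup>2 + s\<^sup>2 = 2m\<close> into \<open>(a - u)\<^sup>2 + 2uv + 2aj = 2m\<close> with \<open>v < 2a\<close>. The sets below are the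
  pieces with \<open>a = u\<close>, \<open>a = u + 2h\<close>, \<open>u = a + 2h\<close>, and, for the complementary range \<open>v > 2a\<close>
  (with \<open>v\<close> shifted by \<open>2a\<close>), \<open>a + u = 2h\<close>.\<close>

definition shell_equal :: "int \<Rightarrow> int set \<Rightarrow> (int \<times> int \<times> int) set" where
  "shell_equal m T = {(u, v, j). odd u \<and> 0 < u \<and> odd v \<and> 0 < v \<and> j \<in> T \<and> u * (v + j) = m}"

definition shell_above :: "int \<Rightarrow> int set \<Rightarrow> (int \<times> int \<times> int \<times> int) set" where
  "shell_above m T = {(h, u, v, j). 0 < h \<and> odd u \<and> 0 < u \<and> odd v \<and> 0 < v \<and> j \<in> T \<and>
     2 * h\<^sup>2 + u * v + (u + 2 * h) * j = m}"

definition shell_below :: "int \<Rightarrow> int set \<Rightarrow> (int \<times> int \<times> int \<times> int) set" where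
  "shell_below m T = {(h, a, v, j). 0 < h \<and> odd a \<and> 0 < a \<and> odd v \<and> 0 < v \<and> j \<in> T \<and>
     2 * h\<^sup>2 + (a + 2 * h) * v + a * j = m}"

definition shell_sum :: "int \<Rightarrow> int set \<Rightarrow> (int \<times> int \<times> int \<times> int) set" where
  "shell_sum m T = {(h, u, v, j). 0 < h \<and> odd u \<and> 0 < u \<and> u < 2 * h \<and> odd v \<and> 0 < v \<and> j \<in> T \<and>
     2 * h\<^sup>2 + u * v + (2 * h - u) * j = m}"

lemma quad_bounds:
  fixes h y x k :: int
  assumes "0 < h" "0 < y" "0 < x" "0 \<le> k" "2 * h\<^sup>2 + y * x + z * k = m" "0 < z"
  shows "h \<le> m" "y \<le> m" "x \<le> m" "k \<le> m"
proof -
  have "h \<le> h\<^sup>2" using abs_le_square[of h] by simp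
  moreover have "y \<le> y * x" "x \<le> y * x" using mult_pos_le assms by auto
  moreover have "k \<le> z * k" using assms by (simp add: mult_le_cancel_right1)
  ultimately show "h \<le> m" "y \<le> m" "x \<le> m" "k \<le> m" using assms by linarith+
qed

lemma finite_shell_sum:
  assumes "T \<subseteq> {0..}"
  shows "finite (shell_sum m T)"
proof (rule finite_subset)
  show "shell_sum m T \<subseteq> {0..m} \<times> {0..m} \<times> {0..m} \<times> {0..m}"
  proof (clarsimp simp: shell_sum_def, goal_cases)
    case (1 h u v j)
    then show ?case using quad_bounds[of h u v j "2 * h - u" m] assms by auto
  qed
qed simp

lemma finite_line_start: "finite (line_start m P)"
proof (rule finite_subset)
  show "line_start m P \<subseteq> {0..m} \<times> {0..m} \<times> {0..m} \<times> {0..m}"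
  proof (clarsimp simp: line_start_def, goal_cases)
    case (1 h y x k)
    then show ?case using quad_bounds[of h y x k "2 * h" m] by auto
  qed
qed simp

lemma finite_line_end: "finite (line_end m P)"
proof (rule finite_subset)
  show "line_end m P \<subseteq> {0..m} \<times> {0..m} \<times> {0..m} \<times> {0..m}"
  proof (clarsimp simp: line_end_def, goal_cases)
    case (1 h y x k)
    then show ?case using quad_bounds[of h y x k "2 * h" m] by auto
  qed
qed simp

text \<open>Regrouping \<open>u * v + (u + 2 * h) * j\<close> as
  \<open>u * (v + j) + 2 * h * j\<close> gives the equation of a line. Positivity of
  \<open>v\<close> is \<open>k < x\<close>, and the parity condition rules out
  \<open>k = x\<close>.\<close>

lemma card_shell_above:
  "card (shell_above m {1..}) = card (line_start m (\<lambda>x k. odd (x + k)))"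
  by (rule card_eq_by_witness[where f = "\<lambda>(h, u, v, j). (h, u, v + j, j)" and g = "\<lambda>(h, u, x, k). (h, u, x - k, k)"])
    (auto simp: shell_above_def line_start_def algebra_simps order_less_le)

text \<open>Now \<open>(a + 2 * h) * v + a * j\<close> is \<open>a * (v + j) + 2 * h * v\<close>, so
  \<open>v\<close> plays the role of \<open>k\<close>. Admitting \<open>j = 0\<close> matches the
  case \<open>k = x\<close>.\<close>

lemma card_shell_below:
  "card (shell_below m {0..}) = card (line_start m (\<lambda>x k. odd k))"
  by (rule card_eq_by_witness[where f = "\<lambda>(h, a, v, j). (h, a, v + j, v)" and g = "\<lambda>(h, y, x, k). (h, y, k, x - k)"])
    (auto simp: shell_below_def line_start_def algebra_simps)

text \<open>The term \<open>u * v + (2 * h - u) * j\<close> is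
  \<open>u * (v - j) + 2 * h * j\<close> for \<open>j < v\<close> and
  \<open>(2 * h - u) * (j - v) + 2 * h * v\<close> for \<open>v < j\<close>. If
  \<open>j = v\<close>, then \<open>m = 2 * h * (h + v)\<close> with \<open>v\<close> odd would be a
  multiple of 4.\<close>

lemma card_shell_sum:
  assumes "odd m \<or> m mod 4 = 2"
  shows "card (shell_sum m {1..}) = card (line_end m (\<lambda>x k. odd (x + k))) + card (line_end m (\<lambda>x k. odd k))"
proof -
  have neq: "j \<noteq> v" if "(h, u, v, j) \<in> shell_sum m {1..}" for h u v j
  proof
    assume "j = v"
    then have "m = 2 * (h * (h + v))" "odd v"
      using that by (auto simp: shell_sum_def power2_eq_square algebra_simps)
    moreover have "even (h * (h + v))" using \<open>odd v\<close> by simp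
    then obtain i where "h * (h + v) = 2 * i" by (elim evenE)
    ultimately show False using assms by presburger
  qed
  have "card (shell_sum m {1..}) = card {(h, u, v, j) \<in> shell_sum m {1..}. j < v}
      + card {(h, u, v, j) \<in> shell_sum m {1..}. \<not> j < v}"
    using card_split[OF finite_shell_sum[of "{1..}" m], of "\<lambda>(h, u, v, j). j < v"]
    by (simp add: case_prod_unfold)
  moreover have "card {(h, u, v, j) \<in> shell_sum m {1..}. j < v} = card (line_end m (\<lambda>x k. odd (x + k)))"
  proof (rule card_eq_by_witness[where f = "\<lambda>(h, u, v, j). (h, u, v - j, j)" and g = "\<lambda>(h, u, x, k). (h, u, x + k, k)"], goal_cases)
    case (1 p)
    then show ?case by (clarsimp simp: shell_sum_def line_end_def; simp add: algebra_simps)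
  next
    case (2 p)
    then show ?case by (clarsimp simp: shell_sum_def line_end_def; simp add: algebra_simps)
  qed
  moreover have "card {(h, u, v, j) \<in> shell_sum m {1..}. \<not> j < v} = card (line_end m (\<lambda>x k. odd k))"
  proof (rule card_eq_by_witness[where f = "\<lambda>(h, u, v, j). (h, 2 * h - u, j - v, v)" and g = "\<lambda>(h, y, x, k). (h, 2 * h - y, k, x + k)"], goal_cases)
    case (1 p)
    then obtain h u v j where p: "p = (h, u, v, j)" and mem: "(h, u, v, j) \<in> shell_sum m {1..}" "\<not> j < v"
      by blast
    then have "v < j" using neq[of h u v j] by simp
    then show ?case using mem unfolding p by (clarsimp simp: shell_sum_def line_end_def; simp add: algebra_simps)
  next
    case (2 p)
    then show ?case by (clarsimp simp: shell_sum_def line_end_def; simp add: algebra_simps)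
  qed
  ultimately show ?thesis by simp
qed

text \<open>The conditions \<open>odd (x + k)\<close> and \<open>odd k\<close> need not be stable
  under adding multiples of \<open>x\<close> to \<open>k\<close>. For odd \<open>m\<close> the
  equation forces \<open>x\<close> odd, the two conditions are complementary, and their counts add
  up to that for the stable condition \<open>odd x\<close>. For even \<open>m\<close> it forces
  \<open>x\<close> even, and both conditions say that \<open>k\<close> is odd, which is
  stable.\<close>

lemma shell_balance:
  assumes "odd m \<or> m mod 4 = 2"
  shows "card (shell_sum m {1..}) = card (shell_above m {1..}) + card (shell_below m {0..})"
proof -
  have par: "even (2 * h\<^sup>2 + y * x + 2 * h * k) \<longleftrightarrow> even x" if "odd y" for h y x k :: int
    using that by simp
  show ?thesis
  proof (cases "odd m")
    case True
    have split: "card A = card {(h, y, x, k) \<in> A. odd (x + k)} + card {(h, y, x, k) \<in> A. \<not> odd (x + k)}"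
      if "finite A" for A :: "(int \<times> int \<times> int \<times> int) set"
      using card_split[OF that, of "\<lambda>(h, y, x, k). odd (x + k)"] by (simp add: case_prod_unfold)
    have "{(h, y, x, k) \<in> line_start m (\<lambda>x k. odd x). odd (x + k)} = line_start m (\<lambda>x k. odd (x + k))"
      "{(h, y, x, k) \<in> line_start m (\<lambda>x k. odd x). \<not> odd (x + k)} = line_start m (\<lambda>x k. odd k)"
      "{(h, y, x, k) \<in> line_end m (\<lambda>x k. odd x). odd (x + k)} = line_end m (\<lambda>x k. odd (x + k))"
      "{(h, y, x, k) \<in> line_end m (\<lambda>x k. odd x). \<not> odd (x + k)} = line_end m (\<lambda>x k. odd k)"
      using True by (auto simp: line_start_def line_end_def)
    then show ?thesis
      using card_line_start_eq_line_end[of "\<lambda>x k. odd x" m]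
        split[OF finite_line_start[of m "\<lambda>x k. odd x"]] split[OF finite_line_end[of m "\<lambda>x k. odd x"]]
      by (simp add: card_shell_above card_shell_below card_shell_sum[OF assms])
  next
    case False
    define P where "P = (\<lambda>(x :: int) (k :: int). even x \<and> odd k)"
    have "line_start m (\<lambda>x k. odd (x + k)) = line_start m P"
      "line_start m (\<lambda>x k. odd k) = line_start m P"
      "line_end m (\<lambda>x k. odd (x + k)) = line_end m P"
      "line_end m (\<lambda>x k. odd k) = line_end m P"
      using False by (auto simp: line_start_def line_end_def P_def)
    moreover have "card (line_start m P) = card (line_end m P)"
      by (rule card_line_start_eq_line_end) (auto simp: P_def)
    ultimately show ?thesis
      by (simp add: card_shell_above card_shell_below card_shell_sum[OF assms])
  qed
qed

lemma finite_shell_above: "T \<subseteq> {0..} \<Longrightarrow> finite (shell_above m T)"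
proof (rule finite_subset)
  assume T: "T \<subseteq> {0..}"
  show "shell_above m T \<subseteq> {0..m} \<times> {0..m} \<times> {0..m} \<times> {0..m}"
  proof (clarsimp simp: shell_above_def, goal_cases)
    case (1 h u v j)
    then show ?case using quad_bounds[of h u v j "u + 2 * h" m] T by auto
  qed
qed simp

lemma finite_shell_below: "T \<subseteq> {0..} \<Longrightarrow> finite (shell_below m T)"
proof (rule finite_subset)
  assume T: "T \<subseteq> {0..}"
  show "shell_below m T \<subseteq> {0..m} \<times> {0..m} \<times> {0..m} \<times> {0..m}"
  proof (clarsimp simp: shell_below_def, goal_cases)
    case (1 h a v j)
    have "0 \<le> 2 * h * v" using 1 by simp
    moreover have "a \<le> a * v" using 1 mult_pos_le(1) by blast
    ultimately have "a \<le> (a + 2 * h) * v" unfolding distrib_right by linarith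
    moreover have "0 < a + 2 * h" using 1 by simp
    ultimately show ?case using 1 quad_bounds[of h "a + 2 * h" v j a m] T by auto
  qed
qed simp

text \<open>At \<open>j = 0\<close>, \<open>shell_above\<close> and \<open>shell_sum\<close> share
  the equation \<open>2 * h\<^sup>2 + u * v = m\<close>, the latter with \<open>u < 2 * h\<close>.
  The solutions with \<open>u > 2 * h\<close> form \<open>shell_below\<close> through
  \<open>u = a + 2 * h\<close>.\<close>

lemma shell_balance_zero: "card (shell_above m {0}) = card (shell_below m {0}) + card (shell_sum m {0})"
proof -
  have "card (shell_above m {0}) = card {(h, u, v, j) \<in> shell_above m {0}. u < 2 * h}
      + card {(h, u, v, j) \<in> shell_above m {0}. \<not> u < 2 * h}"
    using card_split[OF finite_shell_above[of "{0}" m], of "\<lambda>(h, u, v, j). u < 2 * h"]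
    by (simp add: case_prod_unfold)
  moreover have "{(h, u, v, j) \<in> shell_above m {0}. u < 2 * h} = shell_sum m {0}"
    by (auto simp: shell_above_def shell_sum_def)
  moreover have "card {(h, u, v, j) \<in> shell_above m {0}. \<not> u < 2 * h} = card (shell_below m {0})"
  proof (rule card_eq_by_witness[where f = "\<lambda>(h, u, v, j). (h, u - 2 * h, v, j)" and g = "\<lambda>(h, u, v, j). (h, u + 2 * h, v, j)"], goal_cases)
    case (1 p)
    then obtain h u v where p: "p = (h, u, v, 0)" and mem: "(h, u, v, 0) \<in> shell_above m {0}" "\<not> u < 2 * h"
      by (auto simp: shell_above_def)
    have "u \<noteq> 2 * h" using mem by (auto simp: shell_above_def)
    then show ?case using mem unfolding p by (auto simp: shell_above_def shell_below_def)
  next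
    case (2 p)
    then show ?case by (auto simp: shell_above_def shell_below_def)
  qed
  ultimately show ?thesis by simp
qed

lemma shell_below_split: "card (shell_below m {0..}) = card (shell_below m {0}) + card (shell_below m {1..})"
proof -
  have "shell_below m {0..} = shell_below m {0} \<union> shell_below m {1..}"
    by (auto simp: shell_below_def)
  moreover have "card (shell_below m {0} \<union> shell_below m {1..}) = card (shell_below m {0}) + card (shell_below m {1..})"
    by (rule card_Un_disjoint) (auto simp: finite_shell_below, auto simp: shell_below_def)
  ultimately show ?thesis by simp
qed

text \<open>The encoded pairs of a form and an odd \<open>s\<close>, without the bound
  \<open>v < 2 * a\<close>. Taking \<open>T = {0}\<close> gives the case \<open>a = c\<close>, and
  \<open>T = {1..}\<close> the case \<open>a < c\<close>.\<close>

definition shell :: "int \<Rightarrow> int set \<Rightarrow> (int \<times> int \<times> int \<times> int) set" where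
  "shell m T = {(a, u, v, j). odd a \<and> 0 < a \<and> odd u \<and> 0 < u \<and> odd v \<and> 0 < v \<and> j \<in> T \<and>
     (a - u)\<^sup>2 + 2 * u * v + 2 * a * j = 2 * m}"

lemma finite_shell: "T \<subseteq> {0..} \<Longrightarrow> finite (shell m T)"
proof (rule finite_subset)
  assume T: "T \<subseteq> {0..}"
  \<comment> \<open>The bound on \<open>a\<close> comes from
    \<open>a \<le> \<bar>a - u\<bar> + u\<close>, with the first summand at most
    \<open>2 * m\<close> and the second at most \<open>m\<close>.\<close>
  show "shell m T \<subseteq> {0..3 * m} \<times> {0..m} \<times> {0..m} \<times> {0..m}"
  proof (clarsimp simp: shell_def, goal_cases)
    case (1 a u v j)
    then have "0 \<le> j" using T by auto
    then have "0 \<le> a * j" "j \<le> a * j" using 1 by (auto simp: mult_le_cancel_right1)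
    moreover have "u \<le> u * v" "v \<le> u * v" using mult_pos_le 1 by auto
    moreover have "\<bar>a - u\<bar> \<le> (a - u)\<^sup>2" "0 \<le> (a - u)\<^sup>2" by (simp_all add: abs_le_square)
    moreover have "(a - u)\<^sup>2 + 2 * (u * v) + 2 * (a * j) = 2 * m" using 1 by (simp add: mult.assoc)
    ultimately show ?case using \<open>0 \<le> j\<close> 1 by linarith
  qed
qed simp

text \<open>For \<open>v > 2 * a\<close>, subtracting \<open>2 * a\<close> from \<open>v\<close>
  turns \<open>(a - u)\<^sup>2\<close> into \<open>(a + u)\<^sup>2\<close>, which is
  \<open>4 * h\<^sup>2\<close>. The case \<open>v = 2 * a\<close> cannot occur since
  \<open>v\<close> is odd.\<close>

lemma card_shell_cut:
  assumes "T \<subseteq> {0..}"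
  shows "card (shell m T) = card {(a, u, v, j) \<in> shell m T. v < 2 * a} + card (shell_sum m T)"
proof -
  have "card (shell m T) = card {(a, u, v, j) \<in> shell m T. v < 2 * a}
      + card {(a, u, v, j) \<in> shell m T. \<not> v < 2 * a}"
    using card_split[OF finite_shell[OF assms, of m], of "\<lambda>(a, u, v, j). v < 2 * a"]
    by (simp add: case_prod_unfold)
  moreover have "card {(a, u, v, j) \<in> shell m T. \<not> v < 2 * a} = card (shell_sum m T)"
  proof (rule card_eq_by_witness[where f = "\<lambda>(a, u, v, j). ((a + u) div 2, u, v - 2 * a, j)"
        and g = "\<lambda>(h, u, v, j). (2 * h - u, u, v + 2 * (2 * h - u), j)"], goal_cases)
    case (1 p)
    then obtain a u v j where p: "p = (a, u, v, j)" and mem: "(a, u, v, j) \<in> shell m T" "\<not> v < 2 * a"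
      by blast
    have par: "odd a" "0 < a" "odd u" "0 < u" "odd v" "j \<in> T"
      and eq: "(a - u)\<^sup>2 + 2 * u * v + 2 * a * j = 2 * m"
      using mem by (auto simp: shell_def)
    have "even (a + u)" using par by simp
    then obtain h where h: "a + u = 2 * h" by (elim evenE)
    then have a: "a = 2 * h - u" by simp
    have "v \<noteq> 2 * a" using par by auto
    moreover have "2 * h\<^sup>2 + u * (v - 2 * a) + a * j = m"
      using eq unfolding a by (simp add: power2_eq_square algebra_simps)
    ultimately show ?case
      using par mem(2) h unfolding p by (auto simp: shell_sum_def a)
  next
    case (2 p)
    then show ?case
      by (clarsimp simp: shell_def shell_sum_def; simp add: power2_eq_square algebra_simps)
  qed
  ultimately show ?thesis by simp
qed

lemma card_shell_trichotomy:
  assumes "T \<subseteq> {0..}"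
  shows "card (shell m T) = card (shell_equal m T) + card (shell_above m T) + card (shell_below m T)"
proof -
  have "card (shell m T) = card {(a, u, v, j) \<in> shell m T. a = u}
      + card {(a, u, v, j) \<in> shell m T. a < u} + card {(a, u, v, j) \<in> shell m T. u < a}"
    using card_trichotomy[OF finite_shell[OF assms, of m], of "\<lambda>(a, u, v, j). a" "\<lambda>(a, u, v, j). u"]
    by (simp add: case_prod_unfold)
  moreover have "card {(a, u, v, j) \<in> shell m T. a = u} = card (shell_equal m T)"
    by (rule card_eq_by_witness[where f = "\<lambda>(a, u, v, j). (u, v, j)" and g = "\<lambda>(u, v, j). (u, u, v, j)"])
      (auto simp: shell_def shell_equal_def distrib_left mult.assoc)
  moreover have "card {(a, u, v, j) \<in> shell m T. u < a} = card (shell_above m T)"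
  proof (rule card_eq_by_witness[where f = "\<lambda>(a, u, v, j). ((a - u) div 2, u, v, j)"
        and g = "\<lambda>(h, u, v, j). (u + 2 * h, u, v, j)"], goal_cases)
    case (1 p)
    then obtain a u v j where p: "p = (a, u, v, j)" and mem: "(a, u, v, j) \<in> shell m T" "u < a"
      by blast
    then have "even (a - u)" by (simp add: shell_def)
    then obtain h where "a - u = 2 * h" by (elim evenE)
    then have "a = u + 2 * h" by simp
    then show ?case using mem unfolding p
      by (clarsimp simp: shell_def shell_above_def; simp add: power2_eq_square algebra_simps)
  next
    case (2 p)
    then show ?case
      by (clarsimp simp: shell_def shell_above_def; simp add: power2_eq_square algebra_simps)
  qed
  moreover have "card {(a, u, v, j) \<in> shell m T. a < u} = card (shell_below m T)"
  proof (rule card_eq_by_witness[where f = "\<lambda>(a, u, v, j). ((u - a) div 2, a, v, j)"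
        and g = "\<lambda>(h, a, v, j). (a, a + 2 * h, v, j)"], goal_cases)
    case (1 p)
    then obtain a u v j where p: "p = (a, u, v, j)" and mem: "(a, u, v, j) \<in> shell m T" "a < u"
      by blast
    then have "even (u - a)" by (simp add: shell_def)
    then obtain h where "u - a = 2 * h" by (elim evenE)
    then have "u = a + 2 * h" by simp
    then show ?case using mem unfolding p
      by (clarsimp simp: shell_def shell_below_def; simp add: power2_eq_square algebra_simps)
  next
    case (2 p)
    then show ?case
      by (clarsimp simp: shell_def shell_below_def; simp add: power2_eq_square algebra_simps)
  qed
  ultimately show ?thesis by simp
qed

text \<open>Letting \<open>j\<close> take both signs, the left side counts the solutions of
  \<open>u * (v + \<bar>j\<bar>) = m\<close>. For a fixed factorisation \<open>m = u * d\<close>,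
  oddness of \<open>v\<close> leaves the \<open>d\<close> values \<open>j = 2 * i - d - 1\<close>
  with \<open>1 \<le> i \<le> d\<close>.\<close>

lemma card_shell_equal:
  "int (card (shell_equal m {0}) + 2 * card (shell_equal m {1..})) =
    (\<Sum>(u, d)\<in>{(u, d) \<in> divisor_pairs m. odd u}. d)"
proof -
  define D where "D = {(u, d) \<in> divisor_pairs m. odd u}"
  have finD: "finite D" unfolding D_def by (rule finite_subset[OF _ finite_divisor_pairs[of m]]) auto
  define F where "F = {(u, v, j). odd u \<and> 0 < u \<and> odd v \<and> 0 < v \<and> u * (v + \<bar>j\<bar>) = m}"
  define G where "G = Sigma D (\<lambda>(u, d). {1..d})"
  have "finite G" unfolding G_def using finD by auto
  have FG: "bij_betw (\<lambda>(u, v, j). ((u, v + \<bar>j\<bar>), (v + \<bar>j\<bar> + 1 + j) div 2)) F G"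
  proof (rule bij_betw_byWitness[where f' = "\<lambda>((u, d), i). (u, d - \<bar>2 * i - d - 1\<bar>, 2 * i - d - 1)"], goal_cases)
    case 1
    have "2 * ((v + \<bar>j\<bar> + 1 + j) div 2) - (v + \<bar>j\<bar>) - 1 = j" if "odd v" for v j :: int
    proof -
      have "even (v + \<bar>j\<bar> + 1 + j)" using that by simp
      then show ?thesis by simp
    qed
    then show ?case by (simp add: F_def split_paired_all)
  next
    case 2
    show ?case by (simp add: split_paired_all)
  next
    case 3
    have "1 \<le> (v + \<bar>j\<bar> + 1 + j) div 2" "(v + \<bar>j\<bar> + 1 + j) div 2 \<le> v + \<bar>j\<bar>"
      if "odd v" "0 < v" for v j :: int
      using that by auto
    then show ?case by (auto simp: F_def G_def D_def divisor_pairs_def)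
  next
    case 4
    have "odd (d - \<bar>2 * i - d - 1\<bar>)" "\<bar>2 * i - d - 1\<bar> < d" if "1 \<le> i" "i \<le> d" for i d :: int
      using that by auto
    then show ?case by (auto simp: F_def G_def D_def divisor_pairs_def)
  qed
  then have "finite F" using \<open>finite G\<close> bij_betw_finite by blast
  have eq0: "shell_equal m {0} = {(u, v, j) \<in> F. j = 0}"
    and eq1: "shell_equal m {1..} = {(u, v, j) \<in> F. 0 < j}"
    by (auto simp: shell_equal_def F_def)
  have eq2: "card (shell_equal m {1..}) = card {(u, v, j) \<in> F. j < 0}"
    by (rule card_eq_by_witness[where f = "\<lambda>(u, v, j). (u, v, - j)" and g = "\<lambda>(u, v, j). (u, v, - j)"])
      (auto simp: shell_equal_def F_def)
  have "card F = card {(u, v, j) \<in> F. j = 0} + card {(u, v, j) \<in> F. j < 0} + card {(u, v, j) \<in> F. 0 < j}"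
    using card_trichotomy[OF \<open>finite F\<close>, of "\<lambda>(u, v, j). j" "\<lambda>_. 0"]
    by (simp add: case_prod_unfold)
  then have "card F = card (shell_equal m {0}) + 2 * card (shell_equal m {1..})"
    using eq0 eq1 eq2 by simp
  moreover have "card F = card G" using FG by (rule bij_betw_same_card)
  moreover have "int (card G) = (\<Sum>(u, d)\<in>D. d)"
  proof -
    have "card G = (\<Sum>(u, d)\<in>D. nat d)"
      unfolding G_def using finD by (subst card_SigmaI) (auto simp: case_prod_unfold)
    then show ?thesis by (auto simp: case_prod_unfold D_def divisor_pairs_def intro!: sum.cong)
  qed
  ultimately show ?thesis by (simp add: D_def)
qed

text \<open>The inequalities are those of the standard fundamental domain of the principal
  congruence subgroup of level 2. Its boundary, \<open>\<bar>b\<bar> = a\<close> or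
  \<open>\<bar>b\<bar> = c\<close>, is excluded by the parities.\<close>

definition reduced_forms :: "int \<Rightarrow> (int \<times> int \<times> int) set" where
  "reduced_forms M = {(a, c, b). odd a \<and> 0 < a \<and> odd c \<and> 0 < c \<and> even b \<and> \<bar>b\<bar> < a \<and> \<bar>b\<bar> < c \<and>
     a * c - b\<^sup>2 = M}"

text \<open>Compares \<open>b\<^sup>2\<close> with \<open>(a - 1) * (c - 1)\<close>. It yields
  finiteness, and also \<open>s\<^sup>2 < 2 * m\<close> in the relation below.\<close>

lemma reduced_forms_bound:
  fixes a b c :: int
  assumes "\<bar>b\<bar> < a" "\<bar>b\<bar> < c"
  shows "a + c - 1 \<le> a * c - b\<^sup>2"
proof -
  have "\<bar>b\<bar> * \<bar>b\<bar> \<le> (a - 1) * (c - 1)" using assms by (intro mult_mono) auto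
  then show ?thesis by (simp add: power2_eq_square algebra_simps)
qed

lemma finite_reduced_forms [simp]: "finite (reduced_forms M)"
proof (rule finite_subset)
  show "reduced_forms M \<subseteq> {0..M} \<times> {0..M} \<times> {-M..M}"
  proof (clarsimp simp: reduced_forms_def, goal_cases)
    case (1 a c b)
    then show ?case using reduced_forms_bound[of b a c] by auto
  qed
qed simp

text \<open>The pairs of \<open>s\<close> and a form are translated into shells, all of which cancel
  except \<open>shell_equal\<close>, and that one is a divisor sum.\<close>

lemma reduced_forms_sum:
  assumes "odd m \<or> m mod 4 = 2"
  shows "(\<Sum>s\<in>odd_below (2 * m). int (card (reduced_forms (2 * m - s\<^sup>2)))) =
    2 * (\<Sum>(u, d)\<in>{(u, d) \<in> divisor_pairs m. odd u}. d)"
proof -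
  define Y where "Y = Sigma (odd_below (2 * m)) (\<lambda>s. reduced_forms (2 * m - s\<^sup>2))"
  have Y: "Y = {(s, a, c, b). odd s \<and> odd a \<and> 0 < a \<and> odd c \<and> 0 < c \<and> even b \<and> \<bar>b\<bar> < a \<and> \<bar>b\<bar> < c \<and>
     a * c - b\<^sup>2 + s\<^sup>2 = 2 * m}"
  proof -
    have "s\<^sup>2 < 2 * m" if "\<bar>b\<bar> < a" "\<bar>b\<bar> < c" "0 < a" "0 < c" "a * c - b\<^sup>2 + s\<^sup>2 = 2 * m" for a b c s
      using reduced_forms_bound[of b a c] that by linarith
    then show ?thesis unfolding Y_def by (auto simp: odd_below_def reduced_forms_def)
  qed
  have finY: "finite Y" unfolding Y_def by auto
  \<comment> \<open>Negating \<open>s\<close> and \<open>b\<close> exchanges \<open>b < s\<close>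
    with \<open>s < b\<close>, and \<open>s = b\<close> is impossible by parity, so half of
    \<open>Y\<close> suffices.\<close>
  define Z where "Z = {(s, a, c, b) \<in> Y. b < s}"
  have finZ: "finite Z" unfolding Z_def using finY by (rule rev_finite_subset) auto
  have "card Y = card {(s, a, c, b) \<in> Y. b < s} + card {(s, a, c, b) \<in> Y. \<not> b < s}"
    using card_split[OF finY, of "\<lambda>(s, a, c, b). b < s"] by (simp add: case_prod_unfold)
  moreover have "card {(s, a, c, b) \<in> Y. \<not> b < s} = card Z"
  proof -
    have "b \<noteq> s" if "odd s" "even b" for s b :: int using that by auto
    then have "{(s, a, c, b) \<in> Y. \<not> b < s} = {(s, a, c, b) \<in> Y. s < b}"
      by (auto simp: Y order_less_le)
    moreover have "card {(s, a, c, b) \<in> Y. s < b} = card Z"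
      by (rule card_eq_by_witness[where f = "\<lambda>(s, a, c, b). (- s, a, c, - b)" and g = "\<lambda>(s, a, c, b). (- s, a, c, - b)"])
        (auto simp: Z_def Y)
    ultimately show ?thesis by simp
  qed
  ultimately have YZ: "card Y = 2 * card Z" by (simp add: Z_def)
  have "card Z = card {(s, a, c, b) \<in> Z. a = c} + card {(s, a, c, b) \<in> Z. a < c} + card {(s, a, c, b) \<in> Z. c < a}"
    using card_trichotomy[OF finZ, of "\<lambda>(s, a, c, b). a" "\<lambda>(s, a, c, b). c"]
    by (simp add: case_prod_unfold)
  also have "card {(s, a, c, b) \<in> Z. c < a} = card {(s, a, c, b) \<in> Z. a < c}"
    by (rule card_eq_by_witness[where f = "\<lambda>(s, a, c, b). (s, c, a, b)" and g = "\<lambda>(s, a, c, b). (s, c, a, b)"])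
      (auto simp: Z_def Y mult.commute)
  \<comment> \<open>Under the encoding, \<open>\<bar>b\<bar> < a\<close> becomes
    \<open>0 < v\<close> and \<open>v < 2 * a\<close>, while \<open>b < s\<close> becomes
    \<open>0 < u\<close>. The bound \<open>\<bar>b\<bar> < c\<close> follows from
    \<open>a < c\<close>.\<close>
  also have "card {(s, a, c, b) \<in> Z. a < c} = card {(a, u, v, j) \<in> shell m {1..}. v < 2 * a}"
  proof (rule card_eq_by_witness[where f = "\<lambda>(s, a, c, b). (a, s - b, a + b, (c - a) div 2)"
        and g = "\<lambda>(a, u, v, j). (u + v - a, a, a + 2 * j, v - a)"], goal_cases)
    case (1 p)
    then obtain s a c b where p: "p = (s, a, c, b)" and mem: "(s, a, c, b) \<in> Z" "a < c" by blast
    then have "even (c - a)" by (simp add: Z_def Y)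
    then obtain j where "c - a = 2 * j" by (elim evenE)
    then have "c = a + 2 * j" by simp
    then show ?case using mem unfolding p
      by (clarsimp simp: Z_def Y shell_def abs_less_iff; simp add: power2_eq_square algebra_simps)
  next
    case (2 p)
    then show ?case
      by (clarsimp simp: Z_def Y shell_def abs_less_iff; simp add: power2_eq_square algebra_simps)
  qed
  also have "card {(s, a, c, b) \<in> Z. a = c} = card {(a, u, v, j) \<in> shell m {0}. v < 2 * a}"
  proof (rule card_eq_by_witness[where f = "\<lambda>(s, a, c, b). (a, s - b, a + b, 0)"
        and g = "\<lambda>(a, u, v, j). (u + v - a, a, a, v - a)"], goal_cases)
    case (1 p)
    then show ?case
      by (clarsimp simp: Z_def Y shell_def abs_less_iff; simp add: power2_eq_square algebra_simps)
  next
    case (2 p)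
    then show ?case
      by (clarsimp simp: Z_def Y shell_def abs_less_iff; simp add: power2_eq_square algebra_simps)
  qed
  \<comment> \<open>Apart from \<open>shell_equal\<close>, the part with \<open>j = 0\<close>
    contributes above plus below minus sum, which is \<open>2 * card (shell_below m {0})\<close> by
    \<open>shell_balance_zero\<close>. The part with \<open>j \<ge> 1\<close>, counted twice,
    contributes the negative of this by \<open>shell_balance\<close>.\<close>
  finally have "card Z = card (shell_equal m {0}) + 2 * card (shell_equal m {1..})"
    using card_shell_cut[of "{0}" m] card_shell_cut[of "{1..}" m]
      card_shell_trichotomy[of "{0}" m] card_shell_trichotomy[of "{1..}" m]
      shell_balance[OF assms] shell_balance_zero[of m] shell_below_split[of m]
    by simp
  then have "int (card Y) = 2 * (\<Sum>(u, d)\<in>{(u, d) \<in> divisor_pairs m. odd u}. d)"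
    using YZ card_shell_equal[of m] by simp
  moreover have "card Y = (\<Sum>s\<in>odd_below (2 * m). card (reduced_forms (2 * m - s\<^sup>2)))"
    unfolding Y_def by (simp add: card_SigmaI)
  ultimately show ?thesis by simp
qed

section \<open>Sums of three squares\<close>

text \<open>The terms at \<open>s = 1\<close> and \<open>s = - 1\<close> contribute twice the value
  at \<open>n - 1\<close>. Every other argument is \<open>k - 1\<close> with
  \<open>k = n - s\<^sup>2 + 1\<close> smaller than \<open>n\<close> and congruent to it modulo 8,
  so induction stays within the residue class \<open>r\<close>.\<close>

lemma odd_below_deconvolution:
  fixes f g :: "int \<Rightarrow> int"
  assumes conv: "\<And>n. 0 < n \<Longrightarrow> n mod 8 = r \<Longrightarrow>
      (\<Sum>s\<in>odd_below n. f (n - s\<^sup>2)) = (\<Sum>s\<in>odd_below n. g (n - s\<^sup>2))"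
    and "1 < n" "n mod 8 = r"
  shows "f (n - 1) = g (n - 1)"
  using assms(2,3)
proof (induction "nat n" arbitrary: n rule: less_induct)
  case less
  have "f (n - s\<^sup>2) = g (n - s\<^sup>2)" if s: "s \<in> {s \<in> odd_below n. 1 < s\<^sup>2}" for s
  proof -
    define k where "k = n - s\<^sup>2 + 1"
    have "odd s" "s\<^sup>2 < n" "1 < s\<^sup>2" using s by (auto simp: odd_below_def)
    then have "1 < k" "k < n" by (auto simp: k_def)
    define t where "t = s\<^sup>2 div 8"
    have "s\<^sup>2 = 8 * t + 1"
      using odd_square_mod_8[OF \<open>odd s\<close>] mult_div_mod_eq[of 8 "s\<^sup>2"] by (simp add: t_def)
    then have "k = n - 8 * t" by (simp add: k_def)
    moreover have "(n - 8 * t) mod 8 = n mod 8" by presburger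
    ultimately have "k mod 8 = r" using less.prems(2) by simp
    then have "f (k - 1) = g (k - 1)"
      using less.hyps[of k] \<open>1 < k\<close> \<open>k < n\<close> by simp
    then show ?thesis by (simp add: k_def)
  qed
  then have "(\<Sum>s\<in>{s \<in> odd_below n. 1 < s\<^sup>2}. f (n - s\<^sup>2)) = (\<Sum>s\<in>{s \<in> odd_below n. 1 < s\<^sup>2}. g (n - s\<^sup>2))"
    by (rule sum.cong[OF refl])
  moreover have "(\<Sum>s\<in>odd_below n. f (n - s\<^sup>2)) = (\<Sum>s\<in>odd_below n. g (n - s\<^sup>2))"
    using conv less.prems by simp
  ultimately show ?case
    using odd_below_rest[OF less.prems(1), of "\<lambda>s. f (n - s\<^sup>2)"]
      odd_below_rest[OF less.prems(1), of "\<lambda>s. g (n - s\<^sup>2)"] by simp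
qed

lemma sigma_eq_sum_codivisors: "sigma m = (\<Sum>(u, d)\<in>divisor_pairs m. d)"
  unfolding sigma_def
  by (rule sum.reindex_bij_witness[of _ "\<lambda>(d, e). (e, d)" "\<lambda>(d, e). (e, d)"])
    (auto simp: divisor_pairs_def mult.commute)

lemma odd_divisor_pairs_odd:
  assumes "odd m"
  shows "(\<Sum>(u, d)\<in>{(u, d) \<in> divisor_pairs m. odd u}. d) = sigma m"
proof -
  have "{(u, d) \<in> divisor_pairs m. odd u} = divisor_pairs m"
    using assms by (auto simp: divisor_pairs_def)
  then show ?thesis by (simp add: sigma_eq_sum_codivisors)
qed

text \<open>When \<open>u\<close> is odd, the factor 2 lies in \<open>d\<close>, so halving
  \<open>d\<close> gives the divisor pairs of \<open>m\<close>.\<close>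

lemma odd_divisor_pairs_double:
  assumes "odd m"
  shows "(\<Sum>(u, d)\<in>{(u, d) \<in> divisor_pairs (2 * m). odd u}. d) = 2 * sigma m"
proof -
  have "(\<Sum>(u, d)\<in>{(u, d) \<in> divisor_pairs (2 * m). odd u}. d) = (\<Sum>(u, d)\<in>divisor_pairs m. 2 * d)"
  proof (rule sum.reindex_bij_witness[of _ "\<lambda>(u, d). (u, 2 * d)" "\<lambda>(u, d). (u, d div 2)"], goal_cases)
    case (1 p)
    then obtain u d where p: "p = (u, d)" "odd u" "0 < u" "0 < d" "u * d = 2 * m"
      by (auto simp: divisor_pairs_def)
    then have "even d" by (metis dvd_triv_left even_mult_iff)
    then show ?case using p by auto
  next
    case (2 p)
    then obtain u d where p: "p = (u, d)" "odd u" "0 < u" "0 < d" "u * d = 2 * m"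
      by (auto simp: divisor_pairs_def)
    then have "even d" by (metis dvd_triv_left even_mult_iff)
    then obtain e where "d = 2 * e" by (elim evenE)
    then show ?case using p by (auto simp: divisor_pairs_def)
  next
    case (3 p)
    then show ?case by (cases p) auto
  next
    case (4 p)
    then show ?case using assms by (cases p) (auto simp: divisor_pairs_def)
  next
    case (5 p)
    then obtain u d where p: "p = (u, d)" "odd u" "0 < u" "0 < d" "u * d = 2 * m"
      by (auto simp: divisor_pairs_def)
    then have "even d" by (metis dvd_triv_left even_mult_iff)
    then show ?case using p by auto
  qed
  then show ?thesis by (simp add: sigma_eq_sum_codivisors sum_distrib_left case_prod_unfold)
qed

section \<open>Representations by three squares, sorted by parity\<close>

definition three_odd :: "int \<Rightarrow> (int \<times> int \<times> int) set" where
  "three_odd n = {(x, y, z). odd x \<and> odd y \<and> odd z \<and> x\<^sup>2 + y\<^sup>2 + z\<^sup>2 = n}"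

text \<open>The odd entry is confined to the first two places because this is the shape that the
  rotation in \<open>sum_card_one_odd\<close> leaves after one odd square is split off.\<close>

definition one_odd :: "int \<Rightarrow> (int \<times> int \<times> int) set" where
  "one_odd n = {(p, q, t). odd (p + q) \<and> even t \<and> p\<^sup>2 + q\<^sup>2 + t\<^sup>2 = n}"

lemma finite_three_squares: "finite {(x, y, z). x\<^sup>2 + y\<^sup>2 + z\<^sup>2 = (n :: int)}"
proof (rule finite_subset)
  have *: "\<bar>x\<bar> \<le> n \<and> \<bar>y\<bar> \<le> n \<and> \<bar>z\<bar> \<le> n" if "x\<^sup>2 + y\<^sup>2 + z\<^sup>2 = n" for x y z :: int
    using that abs_le_square[of x] abs_le_square[of y] abs_le_square[of z] by linarith
  show "{(x, y, z). x\<^sup>2 + y\<^sup>2 + z\<^sup>2 = n} \<subseteq> {-n..n} \<times> {-n..n} \<times> {-n..n}"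
    using * by (force simp: abs_le_iff)
qed simp

lemma finite_three_odd [simp]: "finite (three_odd n)" and finite_one_odd [simp]: "finite (one_odd n)"
  by (rule finite_subset[OF _ finite_three_squares[of n]], force simp: three_odd_def one_odd_def)+

lemma sum_card_three_odd: "(\<Sum>s\<in>odd_below n. card (three_odd (n - s\<^sup>2))) = card (four_odd n)"
proof -
  have "s\<^sup>2 < n" if "odd x" "s\<^sup>2 + x\<^sup>2 + y\<^sup>2 + z\<^sup>2 = n" for s x y z :: int
  proof -
    have "x \<noteq> 0" using that by auto
    then have "0 < x\<^sup>2" by simp
    then show ?thesis using that zero_le_power2[of y] zero_le_power2[of z] by linarith
  qed
  then have "Sigma (odd_below n) (\<lambda>s. three_odd (n - s\<^sup>2)) = four_odd n"
    by (auto simp: odd_below_def three_odd_def four_odd_def)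
  then show ?thesis by (simp flip: card_SigmaI)
qed

text \<open>Rotating \<open>(x, y)\<close> and \<open>(z, w)\<close> by 45 degrees halves the sum of squares.\<close>

lemma sum_card_one_odd:
  "card (four_odd (2 * n)) = 2 * (\<Sum>s\<in>odd_below n. card (one_odd (n - s\<^sup>2)))"
proof -
  define Q where "Q = {(p, q, r, t). odd (p + q) \<and> odd (r + t) \<and> p\<^sup>2 + q\<^sup>2 + r\<^sup>2 + t\<^sup>2 = n}"
  define S where "S = Sigma (odd_below n) (\<lambda>s. one_odd (n - s\<^sup>2))"
  have "s\<^sup>2 < n" if "odd (p + q)" "p\<^sup>2 + q\<^sup>2 + t\<^sup>2 + s\<^sup>2 = n" for s p q t :: int
  proof -
    have "p \<noteq> 0 \<or> q \<noteq> 0" using that by auto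
    then have "0 < p\<^sup>2 + q\<^sup>2" by (simp add: sum_power2_gt_zero_iff)
    then show ?thesis using that zero_le_power2[of t] by linarith
  qed
  then have S: "S = {(s, p, q, t). odd s \<and> odd (p + q) \<and> even t \<and> p\<^sup>2 + q\<^sup>2 + t\<^sup>2 + s\<^sup>2 = n}"
    by (auto simp: S_def odd_below_def one_odd_def)
  have "finite S" by (simp add: S_def)
  have rot: "bij_betw (\<lambda>(x, y, z, w). ((x + y) div 2, (x - y) div 2, (z + w) div 2, (z - w) div 2)) (four_odd (2 * n)) Q"
  proof (rule bij_betw_byWitness[where f' = "\<lambda>(p, q, r, t). (p + q, p - q, r + t, r - t)"], goal_cases)
    case 1
    have "(x + y) div 2 + (x - y) div 2 = x" "(x + y) div 2 - (x - y) div 2 = y"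
      if "odd x" "odd y" for x y :: int using that by presburger+
    then show ?case by (simp add: four_odd_def split_paired_all)
  next
    case 2
    show ?case by (simp add: split_paired_all)
  next
    case 3
    have *: "even ((x + y) div 2) = odd ((x - y) div 2) \<and> 2 * (((x + y) div 2)\<^sup>2 + ((x - y) div 2)\<^sup>2) = x\<^sup>2 + y\<^sup>2"
      if "odd x" "odd y" for x y :: int
    proof -
      define p q where "p = (x + y) div 2" and "q = (x - y) div 2"
      have xy: "x = p + q" "y = p - q" using that unfolding p_def q_def by presburger+
      have "even p = odd q" using that xy by simp
      moreover have "x\<^sup>2 + y\<^sup>2 = 2 * (p\<^sup>2 + q\<^sup>2)"
        unfolding xy by (simp add: power2_eq_square algebra_simps)
      ultimately show ?thesis by (simp add: p_def q_def)
    qed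
    have add: "A \<and> C \<and> a + b + c + d = n"
      if "A \<and> 2 * (a + b) = e + f" "C \<and> 2 * (c + d) = g + h" "e + f + g + h = 2 * n"
      for A C and a b c d e f g h :: int
      using that by auto
    show ?case
    proof (clarsimp simp: four_odd_def Q_def, goal_cases)
      case (1 x y z w)
      show ?case by (rule add[OF *[OF 1(1,2)] *[OF 1(3,4)] 1(5)])
    qed
  next
    case 4
    show ?case by (clarsimp simp: four_odd_def Q_def; simp add: power2_eq_square algebra_simps)
  qed
  have "finite Q" using rot bij_betw_finite by fastforce
  \<comment> \<open>Exactly one of \<open>r\<close> and \<open>t\<close> is odd, and it serves as
    the \<open>s\<close> of the convolution. The two choices account for the factor 2.\<close>
  then have "card Q = card {(p, q, r, t) \<in> Q. even t} + card {(p, q, r, t) \<in> Q. odd t}"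
    using card_split[of Q "\<lambda>(p, q, r, t). even t"] by (simp add: case_prod_unfold)
  moreover have "card {(p, q, r, t) \<in> Q. even t} = card S"
    by (rule card_eq_by_witness[where f = "\<lambda>(p, q, r, t). (r, p, q, t)" and g = "\<lambda>(s, p, q, t). (p, q, s, t)"])
      (auto simp: Q_def S)
  moreover have "card {(p, q, r, t) \<in> Q. odd t} = card S"
    by (rule card_eq_by_witness[where f = "\<lambda>(p, q, r, t). (t, p, q, r)" and g = "\<lambda>(s, p, q, t). (p, q, t, s)"])
      (auto simp: Q_def S)
  moreover have "card (four_odd (2 * n)) = card Q" using rot by (rule bij_betw_same_card)
  ultimately show ?thesis by (simp add: S_def card_SigmaI)
qed

lemma reduced_forms_nonempty:
  assumes "odd M" "0 < M"
  shows "0 < card (reduced_forms M)"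
proof -
  have "(1, M, 0) \<in> reduced_forms M" using assms by (simp add: reduced_forms_def)
  then show ?thesis by (auto simp: card_gt_0_iff)
qed

text \<open>At \<open>n = 2 * m\<close> with \<open>m\<close> odd the convolution of
  \<open>one_odd\<close> is \<open>8 * sigma m\<close> and that of the forms is
  \<open>2 * sigma m\<close>. The residues 2 and 6 of \<open>M + 1\<close> modulo 8 are those of
  such \<open>n\<close>.\<close>

lemma card_one_odd:
  assumes "M mod 4 = 1" "0 < M"
  shows "card (one_odd M) = 4 * card (reduced_forms M)"
proof -
  define r where "r = (M + 1) mod 8"
  have r: "r = 2 \<or> r = 6" using assms(1) unfolding r_def by presburger
  have "int (card (one_odd (M + 1 - 1))) = 4 * int (card (reduced_forms (M + 1 - 1)))"
  proof (rule odd_below_deconvolution[where r = r and f = "\<lambda>n. int (card (one_odd n))" and g = "\<lambda>n. 4 * int (card (reduced_forms n))"])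
    fix n :: int assume n: "0 < n" "n mod 8 = r"
    define q where "q = n div 8"
    have "n = 8 * q + 2 \<or> n = 8 * q + 6"
      using n(2) r mult_div_mod_eq[of 8 n] unfolding q_def by linarith
    then obtain m where m: "n = 2 * m" "odd m"
      using that[of "4 * q + 1"] that[of "4 * q + 3"] by auto
    then have "int (card (four_odd (2 * n))) = 16 * sigma m" using card_four_odd[of m] n by simp
    moreover have "(\<Sum>s\<in>odd_below n. int (card (reduced_forms (n - s\<^sup>2)))) = 2 * sigma m"
      using reduced_forms_sum[of m] odd_divisor_pairs_odd[of m] m by simp
    ultimately show "(\<Sum>s\<in>odd_below n. int (card (one_odd (n - s\<^sup>2)))) = (\<Sum>s\<in>odd_below n. 4 * int (card (reduced_forms (n - s\<^sup>2))))"
      using sum_card_one_odd[of n] by (simp flip: sum_distrib_left)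
  qed (use assms r_def in auto)
  then show ?thesis by simp
qed

text \<open>At \<open>n = 4 * m\<close> with \<open>m\<close> odd the convolutions are
  \<open>16 * sigma m\<close> and, by the form relation for \<open>2 * m\<close>,
  \<open>4 * sigma m\<close>.\<close>

lemma card_three_odd:
  assumes "M mod 8 = 3" "0 < M"
  shows "card (three_odd M) = 4 * card (reduced_forms M)"
proof -
  have "int (card (three_odd (M + 1 - 1))) = 4 * int (card (reduced_forms (M + 1 - 1)))"
  proof (rule odd_below_deconvolution[where r = 4 and f = "\<lambda>n. int (card (three_odd n))" and g = "\<lambda>n. 4 * int (card (reduced_forms n))"])
    fix n :: int assume n: "0 < n" "n mod 8 = 4"
    define q where "q = n div 8"
    have "n = 8 * q + 4"
      using n(2) mult_div_mod_eq[of 8 n] unfolding q_def by linarith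
    then obtain m where m: "n = 4 * m" "odd m"
      using that[of "2 * q + 1"] by auto
    then have "int (card (four_odd n)) = 16 * sigma m" using card_four_odd[of m] n by simp
    moreover have "2 * m mod 4 = 2" using m by presburger
    then have "(\<Sum>s\<in>odd_below n. int (card (reduced_forms (n - s\<^sup>2)))) = 4 * sigma m"
      using reduced_forms_sum[of "2 * m"] odd_divisor_pairs_double[of m] m by simp
    ultimately show "(\<Sum>s\<in>odd_below n. int (card (three_odd (n - s\<^sup>2)))) = (\<Sum>s\<in>odd_below n. 4 * int (card (reduced_forms (n - s\<^sup>2))))"
      using sum_card_three_odd[of n] by (simp flip: sum_distrib_left of_nat_sum)
  next
    show "(M + 1) mod 8 = 4" using assms(1) by presburger
  qed (use assms in auto)
  then show ?thesis by simp
qed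

section \<open>Existence of three squares and the theorem\<close>

lemma three_squares_odd:
  fixes M :: int
  assumes "0 < M" "M mod 4 = 1 \<or> M mod 8 = 3"
  obtains x y z where "x\<^sup>2 + y\<^sup>2 + z\<^sup>2 = M" "even (x + y)" "odd z"
proof -
  have "odd M" using assms(2) by presburger
  then have pos: "0 < card (reduced_forms M)" using reduced_forms_nonempty assms(1) by simp
  from assms(2) show thesis
  proof
    assume "M mod 4 = 1"
    then have "one_odd M \<noteq> {}" using card_one_odd[of M] pos assms(1) by auto
    then obtain p q t where "odd (p + q)" "even t" "p\<^sup>2 + q\<^sup>2 + t\<^sup>2 = M" by (auto simp: one_odd_def)
    \<comment> \<open>The odd one of \<open>p\<close> and \<open>q\<close> becomes \<open>z\<close>,
      and the other joins the even \<open>t\<close>.\<close>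
    then show thesis using that[of q t p] that[of p t q] by (cases "odd p") (auto simp: algebra_simps)
  next
    assume "M mod 8 = 3"
    then have "three_odd M \<noteq> {}" using card_three_odd[of M] pos assms(1) by auto
    then obtain x y z where "odd x" "odd y" "odd z" "x\<^sup>2 + y\<^sup>2 + z\<^sup>2 = M" by (auto simp: three_odd_def)
    then show thesis using that[of x y z] by auto
  qed
qed

lemma double_triangular: "2 * triangular n = n * (n + 1)"
  unfolding triangular_def by simp

theorem corollary5p5p1:
  fixes N :: nat
  shows "(\<exists>l m n :: int. int N = l\<^sup>2 + m\<^sup>2 + 4 * triangular n) \<longleftrightarrow>
    \<not> (\<exists>k :: nat. N = 4 * k + 3)"
proof
  assume "\<exists>l m n :: int. int N = l\<^sup>2 + m\<^sup>2 + 4 * triangular n"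
  then obtain l m n :: int where N: "int N = l\<^sup>2 + m\<^sup>2 + 4 * triangular n" by blast
  have square: "\<exists>i. x\<^sup>2 = 4 * i \<or> x\<^sup>2 = 4 * i + 1" for x :: int
  proof (cases "even x")
    case True
    then obtain k where "x = 2 * k" by (elim evenE)
    then have "x\<^sup>2 = 4 * k\<^sup>2" by simp
    then show ?thesis by blast
  next
    case False
    then obtain k where "x = 2 * k + 1" by (elim oddE)
    then have "x\<^sup>2 = 4 * (k\<^sup>2 + k) + 1" by (simp add: power2_eq_square algebra_simps)
    then show ?thesis by blast
  qed
  obtain i j where "l\<^sup>2 = 4 * i \<or> l\<^sup>2 = 4 * i + 1" "m\<^sup>2 = 4 * j \<or> m\<^sup>2 = 4 * j + 1"
    using square[of l] square[of m] by blast
  then obtain q where "int N = 4 * q \<or> int N = 4 * q + 1 \<or> int N = 4 * q + 2"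
    using N that[of "i + j + triangular n"] by (auto simp: distrib_left)
  then show "\<not> (\<exists>k :: nat. N = 4 * k + 3)" by presburger
next
  assume "\<not> (\<exists>k :: nat. N = 4 * k + 3)"
  then have "N \<noteq> 4 * (N div 4) + 3" by blast
  moreover have "N = 4 * (N div 4) + N mod 4" "N mod 4 < 4" by simp_all
  ultimately have "N = 4 * (N div 4) \<or> N = 4 * (N div 4) + 1 \<or> N = 4 * (N div 4) + 2" by linarith
  then obtain k :: nat where "N = 4 * k \<or> N = 4 * k + 1 \<or> N = 4 * k + 2" by blast
  \<comment> \<open>The admissible residues of \<open>N\<close> modulo 4 make
    \<open>2 * N + 1\<close> congruent to 1, 3 or 5 modulo 8; the excluded residue 3 corresponds to
    7.\<close>
  then have "2 * int N + 1 = 4 * (2 * int k) + 1 \<or> 2 * int N + 1 = 4 * (2 * int k + 1) + 1 \<or>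
      2 * int N + 1 = 8 * int k + 3"
    by auto
  then have "(2 * int N + 1) mod 4 = 1 \<or> (2 * int N + 1) mod 8 = 3"
    by (elim disjE) (simp_all only: mod_mult_self4, simp_all)
  then obtain x y z where xyz: "x\<^sup>2 + y\<^sup>2 + z\<^sup>2 = 2 * int N + 1" "even (x + y)" "odd z"
    using three_squares_odd[of "2 * int N + 1"] by auto
  define l m n where "l = (x + y) div 2" and "m = (x - y) div 2" and "n = z div 2"
  have xyz_eq: "x = l + m" "y = l - m" "z = 2 * n + 1"
    using xyz(2,3) unfolding l_def m_def n_def by presburger+
  then have "int N = l\<^sup>2 + m\<^sup>2 + 2 * (n * (n + 1))"
    using xyz(1) unfolding xyz_eq by (simp add: power2_eq_square algebra_simps)
  then have "int N = l\<^sup>2 + m\<^sup>2 + 4 * triangular n"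
    using double_triangular[of n] by linarith
  then show "\<exists>l m n :: int. int N = l\<^sup>2 + m\<^sup>2 + 4 * triangular n" by blast
qed

end
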